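(* For $N\in\{2,3,4\}$ let $\mathcal{S}\subset\mathbb{R}^N$ be the set of sector length vectors $(S_1,\dots,S_N)$ of pure $N$-qubit states. Then: (1) for $N=2$, $\mathcal{S}=\{(S_1,S_2): 0\leq S_1\leq 2,\ S_2=3-S_1\}$; (2) for $N=3$, $\mathcal{S}=\{(S_1,S_2,S_3): 0\leq S_1\leq 3,\ S_2=3,\ S_3=4-S_1\}$; (3) for $N=4$, $\mathcal{S}=\{(S_1,S_2,S_3,S_4): 0\leq S_1\leq S_2-2\leq 4,\ S_3=12+S_1-2S_2,\ S_4=3-2S_1+S_2\}$.
   Context: Let $\sigma_0$ be the $2\times 2$ identity and $\sigma_1,\sigma_2,\sigma_3$ the Pauli matrices. For $\boldsymbol{\mu}=(\mu_1,\dots,\mu_N)\in\{0,1,2,3\}^N$ put $\sigma_{\boldsymbol{\mu}}=\sigma_{\mu_1}\otimes\dots\otimes\sigma_{\mu_N}$, and let its weight $\mathrm{wt}(\sigma_{\boldsymbol{\mu}})$ be the number of nonzero entries of $\boldsymbol{\mu}$. For an $N$-qubit state (density matrix) $\rho$ on $(\mathbb{C}^2)^{\otimes N}$, the sector length is $S_m(\rho)=\sum_{\mathrm{wt}(\sigma_{\boldsymbol{\mu}})=m}\mathrm{Tr}(\rho\,\sigma_{\boldsymbol{\mu}})^2$. The sector length vector of a pure state $|\psi\rangle$ (a unit vector in $(\mathbb{C}^2)^{\otimes N}$) is $(S_1(\rho),\dots,S_N(\rho))$ with $\rho=|\psi\rangle\langle\psi|$. *)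

theory Defs
  imports "Jordan_Normal_Form.Matrix"
begin

definition mat_trace :: "'a::comm_monoid_add mat \<Rightarrow> 'a" where
  "mat_trace A = (\<Sum>i<dim_row A. A $$ (i, i))"

definition kron :: "'a::semiring_0 mat \<Rightarrow> 'a mat \<Rightarrow> 'a mat" where
  "kron A B = mat (dim_row A * dim_row B) (dim_col A * dim_col B)
     (\<lambda>(i, j). A $$ (i div dim_row B, j div dim_col B) * B $$ (i mod dim_row B, j mod dim_col B))"

text \<open>Only the values of \<open>pauli\<close> at \<open>0, 1, 2, 3\<close> are ever used.\<close>

definition pauli :: "nat \<Rightarrow> complex mat" where
  "pauli k =
    (if k = 0 then mat_of_rows_list 2 [[1, 0], [0, 1]]
     else if k = 1 then mat_of_rows_list 2 [[0, 1], [1, 0]]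
     else if k = 2 then mat_of_rows_list 2 [[0, - \<i>], [\<i>, 0]]
     else mat_of_rows_list 2 [[1, 0], [0, - 1]])"

definition pauli_string :: "nat list \<Rightarrow> complex mat" where
  "pauli_string \<mu> = foldr kron (map pauli \<mu>) (1\<^sub>m 1)"

definition pauli_indices :: "nat \<Rightarrow> nat list set" where
  "pauli_indices N = {\<mu>. length \<mu> = N \<and> set \<mu> \<subseteq> {0, 1, 2, 3}}"

definition weight :: "nat list \<Rightarrow> nat" where
  "weight \<mu> = card {i. i < length \<mu> \<and> \<mu> ! i \<noteq> 0}"

text \<open>For a density matrix \<open>\<rho>\<close> the traces below are real, since \<open>\<rho>\<close> and the Pauli strings are
  Hermitian, so \<open>Re\<close> is then merely the coercion to the reals.\<close>

definition sector_length :: "nat \<Rightarrow> nat \<Rightarrow> complex mat \<Rightarrow> real" where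
  "sector_length N m \<rho> =
    (\<Sum>\<mu> \<in> {\<mu> \<in> pauli_indices N. weight \<mu> = m}. (Re (mat_trace (\<rho> * pauli_string \<mu>)))\<^sup>2)"

text \<open>\<open>(\<complex>\<^sup>2)\<^sup>\<otimes>\<^sup>N\<close> is identified with \<open>\<complex>\<close> to the power \<open>2 ^ N\<close> via the lexicographically ordered product
  basis, which is the ordering used by \<open>kron\<close>.\<close>

definition pure_state :: "nat \<Rightarrow> complex vec \<Rightarrow> bool" where
  "pure_state N \<psi> \<longleftrightarrow> \<psi> \<in> carrier_vec (2 ^ N) \<and> \<psi> \<bullet>c \<psi> = 1"

definition ketbra :: "complex vec \<Rightarrow> complex mat" where
  "ketbra \<psi> = mat (dim_vec \<psi>) (dim_vec \<psi>) (\<lambda>(i, j). \<psi> $ i * cnj (\<psi> $ j))"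

text \<open>The entry at index \<open>i\<close> is \<open>S\<^sub>m\<close> for \<open>m = i + 1\<close>, as vectors are indexed from \<open>0\<close>.\<close>

definition sector_length_vector :: "nat \<Rightarrow> complex vec \<Rightarrow> real vec" where
  "sector_length_vector N \<psi> = vec N (\<lambda>i. sector_length N (i + 1) (ketbra \<psi>))"

definition pure_sector_length_vectors :: "nat \<Rightarrow> real vec set" where
  "pure_sector_length_vectors N = {sector_length_vector N \<psi> | \<psi>. pure_state N \<psi>}"

end

(* Put e(mu) = <psi|sigma_mu|psi>. Since the sum of sigma_k (x) sigma_k over k is 2 SWAP, the weight enumerator
   S(x,y) = sum_mu x^(N - wt mu) y^(wt mu) e(mu)^2 of a pure state satisfies the MacWilliams identity
   S(x,y) = S((x + 3y)/2, (x - y)/2), which expresses that complementary reductions have the same purity, and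
   S(1,-1) = 2^N |t|^2 with t the overlap of psi and its spin flip. Together they give all linear relations and,
   for N = 4, S_2 = S_1 + 2 + 4 |t|^2. The remaining bound S_1 + 4 |t|^2 <= 4 is Bessel's inequality at each qubit:
   writing psi = |0>p + |1>q, the vector q is orthogonal to its three-qubit spin flip. *)

theory Submission
  imports Defs
begin

text \<open>Amplitudes are functions on indices rather than vectors: for n + 1 qubits,
  \<open>u\<close> and \<open>shift (2 ^ n) u\<close>, read below \<open>2 ^ n\<close>, are the
  components along |0> and |1> of the first qubit.\<close>

definition shift :: "nat \<Rightarrow> (nat \<Rightarrow> 'a) \<Rightarrow> nat \<Rightarrow> 'a" where
  "shift n u = (\<lambda>i. u (n + i))"

lemma shift_apply [simp]: "shift n u i = u (n + i)"
  by (simp add: shift_def)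

lemma sum_lessThan_double:
  fixes f :: "nat \<Rightarrow> 'a::comm_monoid_add"
  shows "sum f {..<2 * n} = sum f {..<n} + (\<Sum>i<n. f (n + i))"
  by (simp add: mult_2 lessThan_atLeast0 add.commute sum.shift_bounds_nat_ivl[of f 0 n n, simplified]
      sum.atLeastLessThan_concat[of 0 n "n + n", symmetric])

section \<open>Pauli matrix elements\<close>

lemma pauli_dim [simp]: "dim_row (pauli k) = 2" "dim_col (pauli k) = 2"
  by (auto simp: pauli_def mat_of_rows_list_def)

lemma pauli_entries [simp]:
  "pauli 0 $$ (0, 0) = 1" "pauli 0 $$ (0, Suc 0) = 0" "pauli 0 $$ (Suc 0, 0) = 0" "pauli 0 $$ (Suc 0, Suc 0) = 1"
  "pauli (Suc 0) $$ (0, 0) = 0" "pauli (Suc 0) $$ (0, Suc 0) = 1"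
  "pauli (Suc 0) $$ (Suc 0, 0) = 1" "pauli (Suc 0) $$ (Suc 0, Suc 0) = 0"
  "pauli 2 $$ (0, 0) = 0" "pauli 2 $$ (0, Suc 0) = - \<i>" "pauli 2 $$ (Suc 0, 0) = \<i>" "pauli 2 $$ (Suc 0, Suc 0) = 0"
  "pauli 3 $$ (0, 0) = 1" "pauli 3 $$ (0, Suc 0) = 0" "pauli 3 $$ (Suc 0, 0) = 0" "pauli 3 $$ (Suc 0, Suc 0) = -1"
  by (simp_all add: pauli_def mat_of_rows_list_def)

lemma pauli_string_Nil: "pauli_string [] = 1\<^sub>m 1"
  by (simp add: pauli_string_def)

lemma pauli_string_Cons: "pauli_string (k # \<mu>) = kron (pauli k) (pauli_string \<mu>)"
  by (simp add: pauli_string_def)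

lemma pauli_string_dim [simp]:
  "dim_row (pauli_string \<mu>) = 2 ^ length \<mu>" "dim_col (pauli_string \<mu>) = 2 ^ length \<mu>"
  by (induction \<mu>) (simp_all add: pauli_string_Nil pauli_string_Cons kron_def)

lemma pauli_string_Cons_entries:
  fixes \<mu> :: "nat list"
  defines "n \<equiv> 2 ^ length \<mu>"
  assumes "i < n" "j < n"
  shows "pauli_string (k # \<mu>) $$ (i, j) = pauli k $$ (0, 0) * pauli_string \<mu> $$ (i, j)"
    and "pauli_string (k # \<mu>) $$ (i, n + j) = pauli k $$ (0, Suc 0) * pauli_string \<mu> $$ (i, j)"
    and "pauli_string (k # \<mu>) $$ (n + i, j) = pauli k $$ (Suc 0, 0) * pauli_string \<mu> $$ (i, j)"
    and "pauli_string (k # \<mu>) $$ (n + i, n + j) = pauli k $$ (Suc 0, Suc 0) * pauli_string \<mu> $$ (i, j)"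
  using assms by (simp_all add: pauli_string_Cons kron_def div_add_self1)

text \<open>The matrix element \<open>\<langle>v|\<sigma>\<^sub>\<mu>|u\<rangle>\<close>.\<close>

definition pauli_elem :: "nat list \<Rightarrow> (nat \<Rightarrow> complex) \<Rightarrow> (nat \<Rightarrow> complex) \<Rightarrow> complex" where
  "pauli_elem \<mu> u v = (\<Sum>i<2 ^ length \<mu>. \<Sum>j<2 ^ length \<mu>. u j * cnj (v i) * pauli_string \<mu> $$ (i, j))"

lemma pauli_elem_Nil [simp]: "pauli_elem [] u v = u 0 * cnj (v 0)"
  by (simp add: pauli_elem_def pauli_string_Nil)

text \<open>Off-diagonal entries of \<open>pauli k\<close> pair different halves of the amplitudes,
  so inductions over the qubits need two independent vectors even though only u = v = psi matters in
  the end.\<close>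

lemma pauli_elem_Cons:
  fixes \<mu> :: "nat list"
  defines "n \<equiv> 2 ^ length \<mu>"
  shows "pauli_elem (k # \<mu>) u v =
    pauli k $$ (0, 0) * pauli_elem \<mu> u v + pauli k $$ (0, Suc 0) * pauli_elem \<mu> (shift n u) v +
    pauli k $$ (Suc 0, 0) * pauli_elem \<mu> u (shift n v) +
    pauli k $$ (Suc 0, Suc 0) * pauli_elem \<mu> (shift n u) (shift n v)"
  unfolding pauli_elem_def n_def length_Cons power_Suc sum_lessThan_double
  by (simp add: pauli_string_Cons_entries sum.distrib sum_distrib_left mult_ac cong: sum.cong_simp)

text \<open>Literal offsets let simp evaluate a concrete string as a polynomial in the
  amplitudes.\<close>

lemma pauli_elem_unfold:
  "pauli_elem [k] u v = pauli k $$ (0, 0) * pauli_elem [] u v + pauli k $$ (0, Suc 0) * pauli_elem [] (shift 1 u) v +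
      pauli k $$ (Suc 0, 0) * pauli_elem [] u (shift 1 v) +
      pauli k $$ (Suc 0, Suc 0) * pauli_elem [] (shift 1 u) (shift 1 v)"
  "pauli_elem [k, l] u v = pauli k $$ (0, 0) * pauli_elem [l] u v + pauli k $$ (0, Suc 0) * pauli_elem [l] (shift 2 u) v +
      pauli k $$ (Suc 0, 0) * pauli_elem [l] u (shift 2 v) +
      pauli k $$ (Suc 0, Suc 0) * pauli_elem [l] (shift 2 u) (shift 2 v)"
  "pauli_elem [k, l, m] u v = pauli k $$ (0, 0) * pauli_elem [l, m] u v + pauli k $$ (0, Suc 0) * pauli_elem [l, m] (shift 4 u) v +
      pauli k $$ (Suc 0, 0) * pauli_elem [l, m] u (shift 4 v) +
      pauli k $$ (Suc 0, Suc 0) * pauli_elem [l, m] (shift 4 u) (shift 4 v)"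
  "pauli_elem [k, l, m, n] u v = pauli k $$ (0, 0) * pauli_elem [l, m, n] u v + pauli k $$ (0, Suc 0) * pauli_elem [l, m, n] (shift 8 u) v +
      pauli k $$ (Suc 0, 0) * pauli_elem [l, m, n] u (shift 8 v) +
      pauli k $$ (Suc 0, Suc 0) * pauli_elem [l, m, n] (shift 8 u) (shift 8 v)"
  by (simp_all add: pauli_elem_Cons eval_nat_numeral del: pauli_elem_Nil)

lemma mat_trace_ketbra:
  assumes "\<psi> \<in> carrier_vec (2 ^ length \<mu>)"
  shows "mat_trace (ketbra \<psi> * pauli_string \<mu>) = pauli_elem \<mu> (($) \<psi>) (($) \<psi>)"
proof -
  have "mat_trace (ketbra \<psi> * pauli_string \<mu>) =
      (\<Sum>j<2 ^ length \<mu>. \<Sum>i<2 ^ length \<mu>. \<psi> $ j * cnj (\<psi> $ i) * pauli_string \<mu> $$ (i, j))"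
    using assms by (simp add: mat_trace_def ketbra_def scalar_prod_def lessThan_atLeast0)
  also have "\<dots> = pauli_elem \<mu> (($) \<psi>) (($) \<psi>)"
    unfolding pauli_elem_def by (rule sum.swap)
  finally show ?thesis .
qed

text \<open>Hermiticity of Pauli strings, inherited from the single factors.\<close>

lemma cnj_pauli_elem:
  assumes "set \<mu> \<subseteq> {0, 1, 2, 3}"
  shows "cnj (pauli_elem \<mu> u v) = pauli_elem \<mu> v u"
  using assms by (induction \<mu> arbitrary: u v) (auto simp: pauli_elem_Cons algebra_simps)

lemma pauli_elem_replicate_0: "pauli_elem (replicate N 0) u v = (\<Sum>i<2 ^ N. u i * cnj (v i))"
  by (induction N arbitrary: u v) (simp_all add: pauli_elem_Cons sum_lessThan_double)

section \<open>Weights\<close>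

lemma weight_Nil [simp]: "weight [] = 0"
  by (simp add: weight_def)

lemma weight_eq_filter: "weight \<mu> = length (filter (\<lambda>k. k \<noteq> 0) \<mu>)"
  by (simp add: weight_def length_filter_conv_card)

lemma weight_Cons [simp]: "weight (k # \<mu>) = (if k = 0 then weight \<mu> else Suc (weight \<mu>))"
  by (simp add: weight_eq_filter)

lemma weight_le_length: "weight \<mu> \<le> length \<mu>"
  by (simp add: weight_eq_filter)

lemma weight_eq_0_iff: "weight \<mu> = 0 \<longleftrightarrow> \<mu> = replicate (length \<mu>) 0"
  by (induction \<mu>) auto

lemma pauli_indices_0 [simp]: "pauli_indices 0 = {[]}"
  by (auto simp: pauli_indices_def)

lemma pauli_indices_Suc: "pauli_indices (Suc N) = (\<lambda>(k, \<mu>). k # \<mu>) ` ({0, 1, 2, 3} \<times> pauli_indices N)"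
  unfolding pauli_indices_def image_def by (auto simp: length_Suc_conv)

lemma finite_pauli_indices [simp]: "finite (pauli_indices N)"
  by (induction N) (simp_all add: pauli_indices_Suc)

lemma sum_pauli_indices_Suc:
  "(\<Sum>\<mu>\<in>pauli_indices (Suc N). f \<mu>) = (\<Sum>\<mu>\<in>pauli_indices N. f (0 # \<mu>) + f (1 # \<mu>) + f (2 # \<mu>) + f (3 # \<mu>))"
  for f :: "nat list \<Rightarrow> 'a::comm_monoid_add"
proof -
  have "(\<Sum>\<mu>\<in>pauli_indices (Suc N). f \<mu>) = (\<Sum>(k, \<mu>)\<in>{0, 1, 2, 3} \<times> pauli_indices N. f (k # \<mu>))"
    unfolding pauli_indices_Suc by (subst sum.reindex) (auto simp: inj_on_def intro!: sum.cong)
  also have "\<dots> = (\<Sum>k\<in>{0, 1, 2, 3}. \<Sum>\<mu>\<in>pauli_indices N. f (k # \<mu>))"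
    by (simp only: sum.cartesian_product)
  also have "\<dots> = (\<Sum>\<mu>\<in>pauli_indices N. f (0 # \<mu>) + f (1 # \<mu>) + f (2 # \<mu>) + f (3 # \<mu>))"
    by (simp add: sum.distrib add_ac)
  finally show ?thesis .
qed

lemma weight_0_indices: "{\<mu> \<in> pauli_indices N. weight \<mu> = 0} = {replicate N 0}"
  by (auto simp: weight_eq_0_iff pauli_indices_def)

text \<open>The only nonzero entry is either the head, followed by zeros, or lies in the
  tail.\<close>

lemma sum_weight_1_Suc:
  fixes f :: "nat list \<Rightarrow> 'a::comm_monoid_add"
  shows "(\<Sum>\<mu> | \<mu> \<in> pauli_indices (Suc N) \<and> weight \<mu> = 1. f \<mu>) =
    f (1 # replicate N 0) + f (2 # replicate N 0) + f (3 # replicate N 0) +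
    (\<Sum>\<mu> | \<mu> \<in> pauli_indices N \<and> weight \<mu> = 1. f (0 # \<mu>))"
proof -
  have *: "(\<Sum>\<mu> | \<mu> \<in> pauli_indices N \<and> weight \<mu> = 0. g \<mu>) = g (replicate N 0)" for g :: "nat list \<Rightarrow> 'a"
    by (simp add: weight_0_indices)
  have "(\<Sum>\<mu> | \<mu> \<in> pauli_indices (Suc N) \<and> weight \<mu> = 1. f \<mu>) =
      (\<Sum>\<mu>\<in>pauli_indices (Suc N). if weight \<mu> = 1 then f \<mu> else 0)"
    by (simp only: sum.inter_filter[OF finite_pauli_indices])
  also have "\<dots> = (\<Sum>\<mu>\<in>pauli_indices N. if weight \<mu> = 1 then f (0 # \<mu>) else 0) +
     (\<Sum>\<mu>\<in>pauli_indices N. if weight \<mu> = 0 then f (1 # \<mu>) else 0) +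
     (\<Sum>\<mu>\<in>pauli_indices N. if weight \<mu> = 0 then f (2 # \<mu>) else 0) +
     (\<Sum>\<mu>\<in>pauli_indices N. if weight \<mu> = 0 then f (3 # \<mu>) else 0)"
    by (simp add: sum_pauli_indices_Suc sum.distrib)
  also have "\<dots> = (\<Sum>\<mu> | \<mu> \<in> pauli_indices N \<and> weight \<mu> = 1. f (0 # \<mu>)) +
     f (1 # replicate N 0) + f (2 # replicate N 0) + f (3 # replicate N 0)"
    by (simp only: sum.inter_filter[OF finite_pauli_indices, symmetric] *)
  finally show ?thesis by (simp add: add_ac)
qed

lemma sum_weight_1_0: "(\<Sum>\<mu> | \<mu> \<in> pauli_indices 0 \<and> weight \<mu> = 1. f \<mu>) = 0"
  by (rule sum.neutral) auto

section \<open>The weight enumerator\<close>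

text \<open>The weight enumerator in polarised form: the recursion mixes the halves of the four
  vectors, and the MacWilliams identity exchanges \<open>v\<close> and \<open>v'\<close>.\<close>

definition pauli_enum ::
  "nat \<Rightarrow> complex \<Rightarrow> complex \<Rightarrow> (nat \<Rightarrow> complex) \<Rightarrow> (nat \<Rightarrow> complex) \<Rightarrow> (nat \<Rightarrow> complex) \<Rightarrow> (nat \<Rightarrow> complex) \<Rightarrow> complex"
  where "pauli_enum N x y u v u' v' =
    (\<Sum>\<mu>\<in>pauli_indices N. x ^ (N - weight \<mu>) * y ^ weight \<mu> * (pauli_elem \<mu> u v * pauli_elem \<mu> u' v'))"

lemma pauli_enum_0 [simp]: "pauli_enum 0 x y u v u' v' = u 0 * cnj (v 0) * (u' 0 * cnj (v' 0))"
  by (simp add: pauli_enum_def)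

text \<open>The completeness relation \<open>\<Sum>\<^sub>k \<sigma>\<^sub>k \<otimes> \<sigma>\<^sub>k = 2 SWAP\<close> on the first qubit.\<close>

lemma pauli_enum_Suc:
  fixes N :: nat and x y :: complex and u v u' v' :: "nat \<Rightarrow> complex"
  defines "s \<equiv> shift (2 ^ N) :: (nat \<Rightarrow> complex) \<Rightarrow> nat \<Rightarrow> complex"
  shows "pauli_enum (Suc N) x y u v u' v' =
    (x - y) * (pauli_enum N x y u v u' v' + pauli_enum N x y (s u) (s v) u' v' +
               pauli_enum N x y u v (s u') (s v') + pauli_enum N x y (s u) (s v) (s u') (s v')) +
    2 * y * (pauli_enum N x y u v u' v' + pauli_enum N x y (s u) v u' (s v') +
             pauli_enum N x y u (s v) (s u') v' + pauli_enum N x y (s u) (s v) (s u') (s v'))"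
  unfolding pauli_enum_def sum_pauli_indices_Suc sum_distrib_left sum.distrib[symmetric]
proof (rule sum.cong[OF refl], goal_cases)
  case (1 \<mu>)
  then have len: "length \<mu> = N" and le: "weight \<mu> \<le> N"
    using weight_le_length[of \<mu>] by (auto simp: pauli_indices_def)
  define X where "X = x ^ (N - weight \<mu>) * y ^ weight \<mu>"
  \<comment> \<open>Head 0 contributes \<open>x\<close>, the other heads \<open>y\<close>.
    Completing the latter to \<open>y\<close> times the sum over all four heads, which is 2 y SWAP,
    leaves \<open>x - y\<close> for the identity.\<close>
  have X: "x ^ (Suc N - weight (0 # \<mu>)) * y ^ weight (0 # \<mu>) = x * X"
    "x ^ (Suc N - weight (1 # \<mu>)) * y ^ weight (1 # \<mu>) = y * X"
    "x ^ (Suc N - weight (2 # \<mu>)) * y ^ weight (2 # \<mu>) = y * X"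
    "x ^ (Suc N - weight (3 # \<mu>)) * y ^ weight (3 # \<mu>) = y * X"
    using le by (simp_all add: X_def Suc_diff_le)
  show ?case
    unfolding X X_def[symmetric]
    by (simp add: pauli_elem_Cons len s_def[symmetric], simp add: algebra_simps)
qed

text \<open>Exchanging \<open>v\<close> and \<open>v'\<close> exchanges the terms \<open>\<delta> \<delta>\<close> and \<open>SWAP\<close> at each qubit, i.e. the reduction to a set of
  qubits and that to its complement; on coefficients it acts as \<open>(x - y, 2 y) \<mapsto> (2 y, x - y)\<close>.\<close>

lemma pauli_enum_MacWilliams:
  "pauli_enum N x y u v u' v' = pauli_enum N ((x + 3 * y) / 2) ((x - y) / 2) u v' u' v"
proof (induction N arbitrary: u v u' v')
  case (Suc N)
  have *: "(x + 3 * y) / 2 - (x - y) / 2 = 2 * y" "2 * ((x - y) / 2) = x - y"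
    by (simp_all add: field_simps)
  show ?case
    unfolding pauli_enum_Suc * Suc.IH[symmetric] by (simp add: algebra_simps)
qed simp

text \<open>The bilinear form of \<open>(|01\<rangle> - |10\<rangle>)\<^sup>\<otimes>\<^sup>N\<close>.\<close>

fun singlet_form :: "nat \<Rightarrow> (nat \<Rightarrow> complex) \<Rightarrow> (nat \<Rightarrow> complex) \<Rightarrow> complex" where
  "singlet_form 0 u v = u 0 * v 0"
| "singlet_form (Suc N) u v = singlet_form N u (shift (2 ^ N) v) - singlet_form N (shift (2 ^ N) u) v"

lemma singlet_form_numeral:
  "singlet_form (numeral k) u v = singlet_form (pred_numeral k) u (shift (2 ^ pred_numeral k) v) -
    singlet_form (pred_numeral k) (shift (2 ^ pred_numeral k) u) v"
  by (simp add: numeral_eq_Suc)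

text \<open>Here each qubit carries 2 (1 - SWAP), and 1 - SWAP is the rank-one operator of the
  vector |01> - |10>; hence the factorisation and a factor 2 per qubit.\<close>

lemma pauli_enum_singlet:
  "pauli_enum N 1 (-1) u v u' v' = 2 ^ N * (singlet_form N u u' * cnj (singlet_form N v v'))"
  by (induction N arbitrary: u v u' v') (simp_all add: pauli_enum_Suc algebra_simps)

section \<open>Relations between the sector lengths of a pure state\<close>

lemma of_real_norm_power2: "(complex_of_real (cmod z))\<^sup>2 = z * cnj z"
  by (metis complex_norm_square of_real_power)

lemma pauli_elem_real:
  assumes "set \<mu> \<subseteq> {0, 1, 2, 3}"
  shows "pauli_elem \<mu> u u = of_real (Re (pauli_elem \<mu> u u))"
  using cnj_pauli_elem[OF assms, of u u] by (metis Reals_cnj_iff of_real_Re)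

lemma sector_length_ketbra:
  assumes "\<psi> \<in> carrier_vec (2 ^ N)"
  shows "sector_length N m (ketbra \<psi>) =
    (\<Sum>\<mu> | \<mu> \<in> pauli_indices N \<and> weight \<mu> = m. (Re (pauli_elem \<mu> (($) \<psi>) (($) \<psi>)))\<^sup>2)"
  unfolding sector_length_def
  by (rule sum.cong) (use assms in \<open>auto simp: pauli_indices_def mat_trace_ketbra\<close>)

text \<open>Expectation values are real, so the products become squares, and grouping strings by
  weight makes the sector lengths the coefficients.\<close>

lemma pauli_enum_ketbra:
  assumes "\<psi> \<in> carrier_vec (2 ^ N)"
  shows "pauli_enum N (of_real x) (of_real y) (($) \<psi>) (($) \<psi>) (($) \<psi>) (($) \<psi>) =
    of_real (\<Sum>m\<le>N. x ^ (N - m) * y ^ m * sector_length N m (ketbra \<psi>))"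
proof -
  let ?e = "\<lambda>\<mu>. pauli_elem \<mu> (($) \<psi>) (($) \<psi>)"
  have sub: "weight ` pauli_indices N \<subseteq> {..N}"
    using weight_le_length by (auto simp: pauli_indices_def)
  have "pauli_enum N (of_real x) (of_real y) (($) \<psi>) (($) \<psi>) (($) \<psi>) (($) \<psi>) =
      (\<Sum>\<mu>\<in>pauli_indices N. of_real (x ^ (N - weight \<mu>) * y ^ weight \<mu> * (Re (?e \<mu>))\<^sup>2))"
    unfolding pauli_enum_def
  proof (rule sum.cong[OF refl], goal_cases)
    case (1 \<mu>)
    then have "?e \<mu> = of_real (Re (?e \<mu>))"
      by (intro pauli_elem_real) (auto simp: pauli_indices_def)
    then show ?case
      by (metis of_real_mult of_real_power power2_eq_square)
  qed
  also have "\<dots> = of_real (\<Sum>m\<le>N. \<Sum>\<mu> | \<mu> \<in> pauli_indices N \<and> weight \<mu> = m.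
      x ^ (N - weight \<mu>) * y ^ weight \<mu> * (Re (?e \<mu>))\<^sup>2)"
    using sum.group[OF finite_pauli_indices _ sub, of "\<lambda>\<mu>. x ^ (N - weight \<mu>) * y ^ weight \<mu> * (Re (?e \<mu>))\<^sup>2"]
    by simp
  also have "\<dots> = of_real (\<Sum>m\<le>N. x ^ (N - m) * y ^ m * sector_length N m (ketbra \<psi>))"
    unfolding sector_length_ketbra[OF assms] sum_distrib_left by (simp cong: sum.cong_simp)
  finally show ?thesis .
qed

text \<open>When all four vectors are psi, exchanging \<open>v\<close> and \<open>v'\<close> changes
  nothing.\<close>

lemma sector_length_MacWilliams:
  assumes "\<psi> \<in> carrier_vec (2 ^ N)"
  shows "(\<Sum>m\<le>N. x ^ (N - m) * y ^ m * sector_length N m (ketbra \<psi>)) =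
    (\<Sum>m\<le>N. ((x + 3 * y) / 2) ^ (N - m) * ((x - y) / 2) ^ m * sector_length N m (ketbra \<psi>))"
proof -
  have *: "complex_of_real ((x + 3 * y) / 2) = (of_real x + 3 * of_real y) / 2"
    "complex_of_real ((x - y) / 2) = (of_real x - of_real y) / 2"
    by simp_all
  show ?thesis
    unfolding of_real_eq_iff[where ?'a = complex, symmetric] pauli_enum_ketbra[OF assms, symmetric] *
    by (rule pauli_enum_MacWilliams)
qed

lemma sector_length_shadow:
  assumes "\<psi> \<in> carrier_vec (2 ^ N)"
  shows "(\<Sum>m\<le>N. (- 1) ^ m * sector_length N m (ketbra \<psi>)) = 2 ^ N * (cmod (singlet_form N (($) \<psi>) (($) \<psi>)))\<^sup>2"
proof -
  have "complex_of_real (\<Sum>m\<le>N. 1 ^ (N - m) * (- 1) ^ m * sector_length N m (ketbra \<psi>)) =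
      of_real (2 ^ N * (cmod (singlet_form N (($) \<psi>) (($) \<psi>)))\<^sup>2)"
    unfolding pauli_enum_ketbra[OF assms, symmetric]
    by (simp add: pauli_enum_singlet of_real_norm_power2)
  then show ?thesis
    unfolding of_real_eq_iff by simp
qed

lemma pure_state_norm:
  assumes "pure_state N \<psi>"
  shows "(\<Sum>i<2 ^ N. \<psi> $ i * cnj (\<psi> $ i)) = 1"
  using assms by (auto simp: pure_state_def scalar_prod_def lessThan_atLeast0)

lemma sector_length_0:
  assumes "pure_state N \<psi>"
  shows "sector_length N 0 (ketbra \<psi>) = 1"
proof -
  have "\<psi> \<in> carrier_vec (2 ^ N)"
    using assms by (simp add: pure_state_def)
  then show ?thesis
    by (simp add: sector_length_ketbra weight_0_indices pauli_elem_replicate_0 pure_state_norm[OF assms])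
qed

section \<open>Linear relations for two, three and four qubits\<close>

lemma sector_lengths_2:
  assumes "pure_state 2 \<psi>"
  defines "S \<equiv> \<lambda>m. sector_length 2 m (ketbra \<psi>)"
  shows "S 2 = 3 - S 1" and "S 1 \<le> 2"
proof -
  have c: "\<psi> \<in> carrier_vec (2 ^ 2)"
    using assms by (simp add: pure_state_def)
  have 0: "S 0 = 1"
    using sector_length_0[OF assms(1)] by (simp add: S_def)
  \<comment> \<open>The point (1, 1) is dual to (2, 0), where only \<open>S 0\<close>
    survives.\<close>
  have 1: "S 0 + S 1 + S 2 = 4 * S 0"
    using sector_length_MacWilliams[OF c, of 1 1] by (simp add: S_def eval_nat_numeral)
  have 2: "0 \<le> S 0 - S 1 + S 2"
    using sector_length_shadow[OF c] by (simp add: S_def eval_nat_numeral)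
  show "S 2 = 3 - S 1" "S 1 \<le> 2"
    using 0 1 2 by linarith+
qed

lemma sector_lengths_3:
  assumes "pure_state 3 \<psi>"
  defines "S \<equiv> \<lambda>m. sector_length 3 m (ketbra \<psi>)"
  shows "S 2 = 3" and "S 3 = 4 - S 1"
proof -
  have c: "\<psi> \<in> carrier_vec (2 ^ 3)"
    using assms by (simp add: pure_state_def)
  have 0: "S 0 = 1"
    using sector_length_0[OF assms(1)] by (simp add: S_def)
  have 1: "S 0 + S 1 + S 2 + S 3 = 8 * S 0"
    using sector_length_MacWilliams[OF c, of 1 1] by (simp add: S_def eval_nat_numeral)
  \<comment> \<open>The point (1, -1) is dual to (-1, 1), and the enumerator has odd degree 3, so
    its value there equals its own negative.\<close>
  have 2: "S 0 - S 1 + S 2 - S 3 = 0"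
    using sector_length_MacWilliams[OF c, of 1 "-1"] by (simp add: S_def eval_nat_numeral)
  show "S 2 = 3" "S 3 = 4 - S 1"
    using 0 1 2 by linarith+
qed

lemma sector_lengths_4:
  assumes "pure_state 4 \<psi>"
  defines "S \<equiv> \<lambda>m. sector_length 4 m (ketbra \<psi>)"
  shows "S 2 = S 1 + 2 + 4 * (cmod (singlet_form 4 (($) \<psi>) (($) \<psi>)))\<^sup>2"
    and "S 3 = 12 + S 1 - 2 * S 2" and "S 4 = 3 - 2 * S 1 + S 2"
proof -
  have c: "\<psi> \<in> carrier_vec (2 ^ 4)"
    using assms by (simp add: pure_state_def)
  have 0: "S 0 = 1"
    using sector_length_0[OF assms(1)] by (simp add: S_def)
  have 1: "S 0 + S 1 + S 2 + S 3 + S 4 = 16 * S 0"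
    using sector_length_MacWilliams[OF c, of 1 1] by (simp add: S_def eval_nat_numeral)
  \<comment> \<open>In even degree (1, -1) yields nothing new; (0, 1), dual to (3/2, -1/2), gives a
    second relation.\<close>
  have 2: "16 * S 4 = 81 * S 0 - 27 * S 1 + 9 * S 2 - 3 * S 3 + S 4"
    using sector_length_MacWilliams[OF c, of 0 1] by (simp add: S_def eval_nat_numeral field_simps)
  have 3: "S 0 - S 1 + S 2 - S 3 + S 4 = 16 * (cmod (singlet_form 4 (($) \<psi>) (($) \<psi>)))\<^sup>2"
    using sector_length_shadow[OF c] unfolding S_def
    by (simp add: eval_nat_numeral del: singlet_form.simps)
  show "S 2 = S 1 + 2 + 4 * (cmod (singlet_form 4 (($) \<psi>) (($) \<psi>)))\<^sup>2"
    "S 3 = 12 + S 1 - 2 * S 2" "S 4 = 3 - 2 * S 1 + S 2"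
    using 0 1 2 3 by linarith+
qed

section \<open>Bounds on the one-body sector length\<close>

text \<open>Bessel's inequality for p against the orthogonal pair q, w, multiplied by the squared
  norm of q. The term of w may be normalised by q as well, since w is no longer than q.\<close>

lemma Bessel_two:
  fixes p q w :: "'a \<Rightarrow> complex"
  assumes orth: "(\<Sum>i\<in>I. q i * cnj (w i)) = 0"
    and le: "(\<Sum>i\<in>I. (cmod (w i))\<^sup>2) \<le> (\<Sum>i\<in>I. (cmod (q i))\<^sup>2)"
    and fin: "finite I"
  shows "(cmod (\<Sum>i\<in>I. p i * cnj (q i)))\<^sup>2 + (cmod (\<Sum>i\<in>I. p i * cnj (w i)))\<^sup>2 \<le>
    (\<Sum>i\<in>I. (cmod (p i))\<^sup>2) * (\<Sum>i\<in>I. (cmod (q i))\<^sup>2)"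
proof -
  define a b e where "a = (\<Sum>i\<in>I. (cmod (p i))\<^sup>2)" "b = (\<Sum>i\<in>I. (cmod (q i))\<^sup>2)" "e = (\<Sum>i\<in>I. (cmod (w i))\<^sup>2)"
  define c d where "c = (\<Sum>i\<in>I. p i * cnj (q i))" "d = (\<Sum>i\<in>I. p i * cnj (w i))"
  note defs = a_b_e_def c_d_def
  have b: "b \<ge> 0"
    by (simp add: defs sum_nonneg)
  show ?thesis
  proof (cases "b = 0")
    case True
    moreover have "e = 0"
      using True le by (simp add: defs sum_nonneg antisym)
    ultimately have "\<forall>i\<in>I. q i = 0" "\<forall>i\<in>I. w i = 0"
      using fin by (simp_all add: defs sum_nonneg_eq_0_iff)
    then show ?thesis by simp
  next
    case False
    have sq: "(\<Sum>i\<in>I. p i * cnj (p i)) = of_real a" "(\<Sum>i\<in>I. q i * cnj (q i)) = of_real b"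
      "(\<Sum>i\<in>I. w i * cnj (w i)) = of_real e"
      by (simp_all add: defs flip: complex_norm_square)
    have orth': "(\<Sum>i\<in>I. w i * cnj (q i)) = 0"
      using arg_cong[OF orth, of cnj] by (simp add: mult.commute)
    have cnj: "(\<Sum>i\<in>I. q i * cnj (p i)) = cnj c" "(\<Sum>i\<in>I. w i * cnj (p i)) = cnj d"
      by (simp_all add: defs mult.commute)
    \<comment> \<open>This is b times a residue of p, which avoids division. Using b instead of e
      for the w-component costs only |d|^2 (b - e), which is nonnegative.\<close>
    define r where "r i = of_real b * p i - c * q i - d * w i" for i
    have "of_real (\<Sum>i\<in>I. (cmod (r i))\<^sup>2) = (\<Sum>i\<in>I. r i * cnj (r i))"
      by (simp flip: complex_norm_square)
    also have "\<dots> = of_real b * of_real b * (\<Sum>i\<in>I. p i * cnj (p i)) - of_real b * cnj c * (\<Sum>i\<in>I. p i * cnj (q i))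
        - of_real b * cnj d * (\<Sum>i\<in>I. p i * cnj (w i)) - of_real b * c * (\<Sum>i\<in>I. q i * cnj (p i))
        + c * cnj c * (\<Sum>i\<in>I. q i * cnj (q i)) + c * cnj d * (\<Sum>i\<in>I. q i * cnj (w i))
        - of_real b * d * (\<Sum>i\<in>I. w i * cnj (p i)) + d * cnj c * (\<Sum>i\<in>I. w i * cnj (q i))
        + d * cnj d * (\<Sum>i\<in>I. w i * cnj (w i))"
      by (simp add: r_def algebra_simps sum.distrib sum_subtractf sum_distrib_left)
    also have "\<dots> = of_real (b * b * a - b * (cmod c)\<^sup>2 - 2 * b * (cmod d)\<^sup>2 + (cmod d)\<^sup>2 * e)"
      unfolding sq orth orth' cnj c_d_def[symmetric]
      by (simp add: of_real_norm_power2 algebra_simps)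
    finally have "b * b * a - b * (cmod c)\<^sup>2 - 2 * b * (cmod d)\<^sup>2 + (cmod d)\<^sup>2 * e = (\<Sum>i\<in>I. (cmod (r i))\<^sup>2)"
      unfolding of_real_eq_iff by simp
    moreover have "(cmod d)\<^sup>2 * e \<le> (cmod d)\<^sup>2 * b"
      using le by (intro mult_left_mono) (simp_all add: defs)
    moreover have "(\<Sum>i\<in>I. (cmod (r i))\<^sup>2) \<ge> 0"
      by (simp add: sum_nonneg)
    ultimately have "0 \<le> b * (a * b - (cmod c)\<^sup>2 - (cmod d)\<^sup>2)"
      by (simp add: algebra_simps)
    then have "0 \<le> a * b - (cmod c)\<^sup>2 - (cmod d)\<^sup>2"
      using b False by (simp add: zero_le_mult_iff)
    then show ?thesis
      by (simp add: defs)
  qed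
qed

text \<open>Here \<open>p\<close> and \<open>q\<close> are the components of a pure state along \<open>|0\<rangle>\<close> and \<open>|1\<rangle>\<close> of one qubit, and \<open>X\<close>, \<open>Y\<close>, \<open>Z\<close>
  the coordinates of the Bloch vector of that qubit.\<close>

lemma Bloch_bound:
  fixes p q w :: "'a \<Rightarrow> complex"
  assumes "(\<Sum>i\<in>I. q i * cnj (w i)) = 0"
    and "(\<Sum>i\<in>I. (cmod (w i))\<^sup>2) \<le> (\<Sum>i\<in>I. (cmod (q i))\<^sup>2)"
    and "finite I"
    and X: "X = (\<Sum>i\<in>I. p i * cnj (q i) + q i * cnj (p i))"
    and Y: "Y = (\<Sum>i\<in>I. \<i> * (p i * cnj (q i) - q i * cnj (p i)))"
    and Z: "Z = (\<Sum>i\<in>I. p i * cnj (p i) - q i * cnj (q i))"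
    and one: "(\<Sum>i\<in>I. p i * cnj (p i) + q i * cnj (q i)) = 1"
  shows "(Re X)\<^sup>2 + (Re Y)\<^sup>2 + (Re Z)\<^sup>2 + 4 * (cmod (\<Sum>i\<in>I. p i * cnj (w i)))\<^sup>2 \<le> 1"
proof -
  define a b c where "a = (\<Sum>i\<in>I. (cmod (p i))\<^sup>2)" "b = (\<Sum>i\<in>I. (cmod (q i))\<^sup>2)" "c = (\<Sum>i\<in>I. p i * cnj (q i))"
  have sq: "(\<Sum>i\<in>I. p i * cnj (p i)) = of_real a" "(\<Sum>i\<in>I. q i * cnj (q i)) = of_real b"
    by (simp_all add: a_b_c_def flip: complex_norm_square)
  have c: "(\<Sum>i\<in>I. q i * cnj (p i)) = cnj c"
    by (simp add: a_b_c_def mult.commute)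
  have "X = c + cnj c" "Y = \<i> * (c - cnj c)" "Z = of_real a - of_real b"
    unfolding X Y Z c[symmetric] sq[symmetric] unfolding a_b_c_def
    by (simp_all add: sum.distrib sum_subtractf flip: sum_distrib_left)
  then have "(Re X)\<^sup>2 + (Re Y)\<^sup>2 + (Re Z)\<^sup>2 = 4 * (cmod c)\<^sup>2 + (a - b)\<^sup>2"
    by (simp add: cmod_power2 power_mult_distrib)
  moreover have "a + b = 1"
    using one unfolding sum.distrib sq by (metis of_real_add of_real_eq_1_iff)
  \<comment> \<open>With a + b = 1 this equals 1 - 4 a b, so the claim is four times the Bessel
    inequality.\<close>
  moreover have "(a - b)\<^sup>2 = (a + b)\<^sup>2 - 4 * (a * b)"
    by (simp add: power2_eq_square algebra_simps)
  ultimately show ?thesis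
    using Bessel_two[OF assms(1-3), of p] by (simp add: a_b_c_def)
qed

lemma sum_lessThan_numerals:
  fixes g :: "nat \<Rightarrow> 'a::comm_monoid_add"
  shows "(\<Sum>i<4. g i) = g 0 + g 1 + g 2 + g 3"
    and "(\<Sum>i<8. g i) = g 0 + g 1 + g 2 + g 3 + g 4 + g 5 + g 6 + g 7"
    and "(\<Sum>i<16. g i) = g 0 + g 1 + g 2 + g 3 + g 4 + g 5 + g 6 + g 7 +
      g 8 + g 9 + g 10 + g 11 + g 12 + g 13 + g 14 + g 15"
  by (simp_all add: eval_nat_numeral)

text \<open>Each triple is the squared length of the Bloch vector of one qubit.\<close>

lemma sector_length_one:
  fixes \<psi> :: "complex vec"
  defines "e \<equiv> \<lambda>\<mu>. (Re (pauli_elem \<mu> (($) \<psi>) (($) \<psi>)))\<^sup>2"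
  shows "\<psi> \<in> carrier_vec 4 \<Longrightarrow> sector_length 2 1 (ketbra \<psi>) =
      e [1, 0] + e [2, 0] + e [3, 0] + (e [0, 1] + e [0, 2] + e [0, 3])"
    and "\<psi> \<in> carrier_vec 8 \<Longrightarrow> sector_length 3 1 (ketbra \<psi>) =
      e [1, 0, 0] + e [2, 0, 0] + e [3, 0, 0] + (e [0, 1, 0] + e [0, 2, 0] + e [0, 3, 0] +
      (e [0, 0, 1] + e [0, 0, 2] + e [0, 0, 3]))"
    and "\<psi> \<in> carrier_vec 16 \<Longrightarrow> sector_length 4 1 (ketbra \<psi>) =
      e [1, 0, 0, 0] + e [2, 0, 0, 0] + e [3, 0, 0, 0] + (e [0, 1, 0, 0] + e [0, 2, 0, 0] + e [0, 3, 0, 0] +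
      (e [0, 0, 1, 0] + e [0, 0, 2, 0] + e [0, 0, 3, 0] + (e [0, 0, 0, 1] + e [0, 0, 0, 2] + e [0, 0, 0, 3])))"
proof -
  have n: "2 = Suc (Suc 0)" "3 = Suc (Suc (Suc 0))" "4 = Suc (Suc (Suc (Suc 0)))"
    by simp_all
  note sums = sum_weight_1_Suc sum_weight_1_0 replicate.simps add_0_right e_def
  show "sector_length 2 1 (ketbra \<psi>) = e [1, 0] + e [2, 0] + e [3, 0] + (e [0, 1] + e [0, 2] + e [0, 3])"
    if "\<psi> \<in> carrier_vec 4"
    by (subst sector_length_ketbra, use that in simp, subst n(1), simp only: sums)
  show "sector_length 3 1 (ketbra \<psi>) =
      e [1, 0, 0] + e [2, 0, 0] + e [3, 0, 0] + (e [0, 1, 0] + e [0, 2, 0] + e [0, 3, 0] +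
      (e [0, 0, 1] + e [0, 0, 2] + e [0, 0, 3]))"
    if "\<psi> \<in> carrier_vec 8"
    by (subst sector_length_ketbra, use that in simp, subst n(2), simp only: sums)
  show "sector_length 4 1 (ketbra \<psi>) =
      e [1, 0, 0, 0] + e [2, 0, 0, 0] + e [3, 0, 0, 0] + (e [0, 1, 0, 0] + e [0, 2, 0, 0] + e [0, 3, 0, 0] +
      (e [0, 0, 1, 0] + e [0, 0, 2, 0] + e [0, 0, 3, 0] + (e [0, 0, 0, 1] + e [0, 0, 0, 2] + e [0, 0, 0, 3])))"
    if "\<psi> \<in> carrier_vec 16"
    by (subst sector_length_ketbra, use that in simp, subst n(3), simp only: sums)
qed

lemma sector_length_3_1_le:
  assumes "pure_state 3 \<psi>"
  shows "sector_length 3 1 (ketbra \<psi>) \<le> 3"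
proof -
  let ?e = "\<lambda>\<mu>. (Re (pauli_elem \<mu> (($) \<psi>) (($) \<psi>)))\<^sup>2"
  have c: "\<psi> \<in> carrier_vec 8"
    using assms by (simp add: pure_state_def)
  have one: "(\<Sum>i<8. \<psi> $ i * cnj (\<psi> $ i)) = 1"
    using pure_state_norm[OF assms] by simp
  note one = one[unfolded sum_lessThan_numerals]
  \<comment> \<open>With \<open>w = 0\<close> only the Bloch ball remains, that is,
    Cauchy-Schwarz.\<close>
  have bound: "(Re X)\<^sup>2 + (Re Y)\<^sup>2 + (Re Z)\<^sup>2 \<le> 1"
    if "X = (\<Sum>i<4. p i * cnj (q i) + q i * cnj (p i))" "Y = (\<Sum>i<4. \<i> * (p i * cnj (q i) - q i * cnj (p i)))"
      "Z = (\<Sum>i<4. p i * cnj (p i) - q i * cnj (q i))" "(\<Sum>i<4. p i * cnj (p i) + q i * cnj (q i)) = 1"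
    for X Y Z and p q :: "nat \<Rightarrow> complex"
    using Bloch_bound[where I = "{..<4}" and w = "\<lambda>_. 0", OF _ _ _ that] by (simp add: sum_nonneg)
  \<comment> \<open>The lists below collect the indices whose bit at the given qubit is 0 (for
    \<open>p\<close>) or 1 (for \<open>q\<close>); the first qubit is the highest bit.\<close>
  have "?e [1, 0, 0] + ?e [2, 0, 0] + ?e [3, 0, 0] \<le> 1"
    by (rule bound[where p = "\<lambda>j. \<psi> $ ([0, 1, 2, 3] ! j)" and q = "\<lambda>j. \<psi> $ ([4, 5, 6, 7] ! j)"];
        unfold sum_lessThan_numerals, use one in \<open>simp add: pauli_elem_unfold algebra_simps flip: numeral_2_eq_2 numeral_3_eq_3\<close>)
  moreover have "?e [0, 1, 0] + ?e [0, 2, 0] + ?e [0, 3, 0] \<le> 1"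
    by (rule bound[where p = "\<lambda>j. \<psi> $ ([0, 1, 4, 5] ! j)" and q = "\<lambda>j. \<psi> $ ([2, 3, 6, 7] ! j)"];
        unfold sum_lessThan_numerals, use one in \<open>simp add: pauli_elem_unfold algebra_simps flip: numeral_2_eq_2 numeral_3_eq_3\<close>)
  moreover have "?e [0, 0, 1] + ?e [0, 0, 2] + ?e [0, 0, 3] \<le> 1"
    by (rule bound[where p = "\<lambda>j. \<psi> $ ([0, 2, 4, 6] ! j)" and q = "\<lambda>j. \<psi> $ ([1, 3, 5, 7] ! j)"];
        unfold sum_lessThan_numerals, use one in \<open>simp add: pauli_elem_unfold algebra_simps flip: numeral_2_eq_2 numeral_3_eq_3\<close>)
  ultimately show ?thesis
    using sector_length_one(2)[OF c] by linarith
qed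

text \<open>\<open>w\<close> is the spin flip of \<open>q\<close> on three qubits. It is orthogonal to \<open>q\<close> because their number is odd.\<close>

lemma Bloch_bound_spin_flip:
  fixes p q :: "nat \<Rightarrow> complex" and sg :: "nat \<Rightarrow> complex"
  defines "sg \<equiv> \<lambda>j. [1, -1, -1, 1, -1, 1, 1, -1] ! j"
  assumes X: "X = (\<Sum>i<8. p i * cnj (q i) + q i * cnj (p i))"
    and Y: "Y = (\<Sum>i<8. \<i> * (p i * cnj (q i) - q i * cnj (p i)))"
    and Z: "Z = (\<Sum>i<8. p i * cnj (p i) - q i * cnj (q i))"
    and one: "(\<Sum>i<8. p i * cnj (p i) + q i * cnj (q i)) = 1"
    and t: "t = 2 * (\<Sum>i<8. sg i * (p i * q (7 - i)))"
  shows "(Re X)\<^sup>2 + (Re Y)\<^sup>2 + (Re Z)\<^sup>2 + (cmod t)\<^sup>2 \<le> 1"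
proof -
  \<comment> \<open>\<open>sg j\<close> is -1 to the number of ones in the binary form of j, and
    \<open>7 - j\<close> flips all three bits. As \<open>sg (7 - j) = - sg j\<close>, the terms of j
    and 7 - j cancel in the product of q with w.\<close>
  define w where "w j = sg j * cnj (q (7 - j))" for j
  have "(\<Sum>i<8. q i * cnj (w i)) = 0"
    by (simp add: w_def sg_def sum_lessThan_numerals)
  moreover have "(\<Sum>i<8. (cmod (w i))\<^sup>2) \<le> (\<Sum>i<8. (cmod (q i))\<^sup>2)"
    by (simp add: w_def sg_def sum_lessThan_numerals norm_mult)
  ultimately have "(Re X)\<^sup>2 + (Re Y)\<^sup>2 + (Re Z)\<^sup>2 + 4 * (cmod (\<Sum>i<8. p i * cnj (w i)))\<^sup>2 \<le> 1"
    by (rule Bloch_bound[OF _ _ _ X Y Z one]) simp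
  moreover have "t = 2 * (\<Sum>i<8. p i * cnj (w i))"
    unfolding t by (simp add: w_def sg_def sum_lessThan_numerals)
  ultimately show ?thesis
    by (simp add: norm_mult power_mult_distrib)
qed

text \<open>The singlet form on psi is invariant under permutations of the qubits, so the same |t|^2
  enters the bound at each of the four qubits; the four bounds add up.\<close>

lemma sector_length_4_1_le:
  assumes "pure_state 4 \<psi>"
  shows "sector_length 4 1 (ketbra \<psi>) + 4 * (cmod (singlet_form 4 (($) \<psi>) (($) \<psi>)))\<^sup>2 \<le> 4"
proof -
  let ?e = "\<lambda>\<mu>. (Re (pauli_elem \<mu> (($) \<psi>) (($) \<psi>)))\<^sup>2"
  define t where "t = singlet_form 4 (($) \<psi>) (($) \<psi>)"
  \<comment> \<open>Indices i and 15 - i are paired. Their signs agree because four is even, whence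
    the factor 2.\<close>
  have t: "t = 2 * (\<psi> $ 0 * \<psi> $ 15 - \<psi> $ 1 * \<psi> $ 14 - \<psi> $ 2 * \<psi> $ 13 + \<psi> $ 3 * \<psi> $ 12
      - \<psi> $ 4 * \<psi> $ 11 + \<psi> $ 5 * \<psi> $ 10 + \<psi> $ 6 * \<psi> $ 9 - \<psi> $ 7 * \<psi> $ 8)"
    unfolding t_def by (simp add: singlet_form_numeral algebra_simps flip: numeral_2_eq_2 numeral_3_eq_3)
  have c: "\<psi> \<in> carrier_vec 16"
    using assms by (simp add: pure_state_def)
  have one: "(\<Sum>i<16. \<psi> $ i * cnj (\<psi> $ i)) = 1"
    using pure_state_norm[OF assms] by simp
  note one = one[unfolded sum_lessThan_numerals]
  have "?e [1, 0, 0, 0] + ?e [2, 0, 0, 0] + ?e [3, 0, 0, 0] + (cmod t)\<^sup>2 \<le> 1"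
    by (rule Bloch_bound_spin_flip[where p = "\<lambda>j. \<psi> $ ([0, 1, 2, 3, 4, 5, 6, 7] ! j)"
          and q = "\<lambda>j. \<psi> $ ([8, 9, 10, 11, 12, 13, 14, 15] ! j)"];
        unfold sum_lessThan_numerals, use one in \<open>simp add: t pauli_elem_unfold algebra_simps flip: numeral_2_eq_2 numeral_3_eq_3\<close>)
  moreover have "?e [0, 1, 0, 0] + ?e [0, 2, 0, 0] + ?e [0, 3, 0, 0] + (cmod t)\<^sup>2 \<le> 1"
    by (rule Bloch_bound_spin_flip[where p = "\<lambda>j. \<psi> $ ([0, 1, 2, 3, 8, 9, 10, 11] ! j)"
          and q = "\<lambda>j. \<psi> $ ([4, 5, 6, 7, 12, 13, 14, 15] ! j)"];
        unfold sum_lessThan_numerals, use one in \<open>simp add: t pauli_elem_unfold algebra_simps flip: numeral_2_eq_2 numeral_3_eq_3\<close>)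
  moreover have "?e [0, 0, 1, 0] + ?e [0, 0, 2, 0] + ?e [0, 0, 3, 0] + (cmod t)\<^sup>2 \<le> 1"
    by (rule Bloch_bound_spin_flip[where p = "\<lambda>j. \<psi> $ ([0, 1, 4, 5, 8, 9, 12, 13] ! j)"
          and q = "\<lambda>j. \<psi> $ ([2, 3, 6, 7, 10, 11, 14, 15] ! j)"];
        unfold sum_lessThan_numerals, use one in \<open>simp add: t pauli_elem_unfold algebra_simps flip: numeral_2_eq_2 numeral_3_eq_3\<close>)
  moreover have "?e [0, 0, 0, 1] + ?e [0, 0, 0, 2] + ?e [0, 0, 0, 3] + (cmod t)\<^sup>2 \<le> 1"
    by (rule Bloch_bound_spin_flip[where p = "\<lambda>j. \<psi> $ ([0, 2, 4, 6, 8, 10, 12, 14] ! j)"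
          and q = "\<lambda>j. \<psi> $ ([1, 3, 5, 7, 9, 11, 13, 15] ! j)"];
        unfold sum_lessThan_numerals, use one in \<open>simp add: t pauli_elem_unfold algebra_simps flip: numeral_2_eq_2 numeral_3_eq_3\<close>)
  ultimately show ?thesis
    using sector_length_one(3)[OF c] unfolding t_def by linarith
qed

section \<open>States attaining the sector lengths\<close>

lemma sector_length_nonneg: "0 \<le> sector_length N m \<rho>"
  unfolding sector_length_def by (rule sum_nonneg) simp

lemma scalar_prod_vec_numerals:
  "vec 4 f \<bullet>c vec 4 f = (\<Sum>i<4. f i * cnj (f i))" "vec 8 f \<bullet>c vec 8 f = (\<Sum>i<8. f i * cnj (f i))"
  "vec 16 f \<bullet>c vec 16 f = (\<Sum>i<16. f i * cnj (f i))"
  by (auto simp: scalar_prod_def lessThan_atLeast0 intro!: sum.cong)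

text \<open>Used for a |0...0> + b |1...1> on c qubits, where every Bloch vector is (0, 0, a^2 -
  b^2).\<close>

lemma exists_two_squares:
  assumes "0 \<le> S" "S \<le> c" "0 < c"
  obtains a b :: real where "a\<^sup>2 + b\<^sup>2 = 1" "c * (a\<^sup>2 - b\<^sup>2)\<^sup>2 = S"
proof -
  define r where "r = sqrt (S / c)"
  have r: "0 \<le> r" "r \<le> 1" "c * r\<^sup>2 = S"
    using assms by (simp_all add: r_def)
  have sq: "(sqrt ((1 + r) / 2))\<^sup>2 = (1 + r) / 2" "(sqrt ((1 - r) / 2))\<^sup>2 = (1 - r) / 2"
    using r by simp_all
  show ?thesis
    by (rule that[of "sqrt ((1 + r) / 2)" "sqrt ((1 - r) / 2)"]) (unfold sq, simp_all add: r field_simps)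
qed

lemma exists_pure_state_2:
  assumes "0 \<le> S" "S \<le> 2"
  obtains \<psi> where "pure_state 2 \<psi>" "sector_length 2 1 (ketbra \<psi>) = S"
proof -
  obtain a b :: real where ab: "a\<^sup>2 + b\<^sup>2 = 1" "2 * (a\<^sup>2 - b\<^sup>2)\<^sup>2 = S"
    using exists_two_squares[of S 2] assms by auto
  define \<psi> :: "complex vec" where "\<psi> = vec 4 (\<lambda>i. if i = 0 then of_real a else if i = 3 then of_real b else 0)"
  have "\<psi> \<bullet>c \<psi> = of_real (a\<^sup>2 + b\<^sup>2)"
    unfolding \<psi>_def scalar_prod_vec_numerals sum_lessThan_numerals by (simp add: power2_eq_square)
  then have "pure_state 2 \<psi>"
    by (simp add: pure_state_def ab) (simp add: \<psi>_def)
  moreover have "sector_length 2 1 (ketbra \<psi>) = S"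
    by (subst sector_length_one)
      (simp_all add: \<psi>_def pauli_elem_unfold flip: numeral_2_eq_2 numeral_3_eq_3 ab, simp add: power2_eq_square)
  ultimately show ?thesis by (rule that)
qed

lemma exists_pure_state_3:
  assumes "0 \<le> S" "S \<le> 3"
  obtains \<psi> where "pure_state 3 \<psi>" "sector_length 3 1 (ketbra \<psi>) = S"
proof -
  obtain a b :: real where ab: "a\<^sup>2 + b\<^sup>2 = 1" "3 * (a\<^sup>2 - b\<^sup>2)\<^sup>2 = S"
    using exists_two_squares[of S 3] assms by auto
  define \<psi> :: "complex vec" where "\<psi> = vec 8 (\<lambda>i. if i = 0 then of_real a else if i = 7 then of_real b else 0)"
  have "\<psi> \<bullet>c \<psi> = of_real (a\<^sup>2 + b\<^sup>2)"
    unfolding \<psi>_def scalar_prod_vec_numerals sum_lessThan_numerals by (simp add: power2_eq_square)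
  then have "pure_state 3 \<psi>"
    by (simp add: pure_state_def ab) (simp add: \<psi>_def)
  moreover have "sector_length 3 1 (ketbra \<psi>) = S"
    by (subst sector_length_one)
      (simp_all add: \<psi>_def pauli_elem_unfold flip: numeral_2_eq_2 numeral_3_eq_3 ab, simp add: power2_eq_square)
  ultimately show ?thesis by (rule that)
qed

text \<open>The witness is \<open>a |0000\<rangle> + b |0011\<rangle> + b |1100\<rangle> + d |1111\<rangle>\<close>. With \<open>s = a + d\<close> and \<open>t = a - d\<close> it has
  \<open>S\<^sub>1 = 4 s\<^sup>2 t\<^sup>2\<close>, and its \<open>singlet_form\<close> is \<open>1 - t\<^sup>2\<close>.\<close>

lemma exists_pure_state_4:
  assumes "0 \<le> S" "0 \<le> D" "S + D \<le> 4"
  obtains \<psi> where "pure_state 4 \<psi>" "sector_length 4 1 (ketbra \<psi>) = S"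
    "4 * (cmod (singlet_form 4 (($) \<psi>) (($) \<psi>)))\<^sup>2 = D"
proof -
  \<comment> \<open>The intended value of the singlet form.\<close>
  define r where "r = sqrt D / 2"
  have D: "D = 4 * r\<^sup>2"
    using assms by (simp add: r_def power_divide)
  have "sqrt D \<le> sqrt 4"
    using assms by (intro real_sqrt_le_mono) simp
  then have r: "0 \<le> r" "r \<le> 1"
    using assms by (simp_all add: r_def)
  \<comment> \<open>\<open>U\<close> will be s^2 and \<open>1 - r\<close> will be t^2, so S = 4 s^2
    t^2. The bound \<open>U \<le> 1 + r\<close> says s^2 + t^2 \<le> 2, which keeps b^2 nonnegative.
    For r = 1 the hypotheses force S = 0.\<close>
  obtain U where U: "0 \<le> U" "U \<le> 1 + r" "4 * (1 - r) * U = S"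
  proof (cases "r = 1")
    case True
    then show ?thesis
      using that[of 0] assms D by simp
  next
    case False
    have "S \<le> 4 * (1 - r) * (1 + r)"
      using assms D by (simp add: algebra_simps power2_eq_square)
    then show ?thesis
      using that[of "S / (4 * (1 - r))"] assms r False by (simp add: pos_divide_le_eq mult_ac)
  qed
  define s t where "s = sqrt U" "t = sqrt (1 - r)"
  have st: "s\<^sup>2 = U" "t\<^sup>2 = 1 - r"
    using U r by (simp_all add: s_t_def)
  \<comment> \<open>\<open>a\<close> and \<open>d\<close> solve a + d = s, a - d = t;
    \<open>b\<close> is fixed by normalisation.\<close>
  define a b d where "a = (s + t) / 2" "b = sqrt ((1 - (s\<^sup>2 + t\<^sup>2) / 2) / 2)" "d = (s - t) / 2"
  have b: "b\<^sup>2 = (1 - (s\<^sup>2 + t\<^sup>2) / 2) / 2"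
    using U by (simp add: a_b_d_def st)
  have ad: "a\<^sup>2 + d\<^sup>2 = (s\<^sup>2 + t\<^sup>2) / 2" "a * d = (s\<^sup>2 - t\<^sup>2) / 4" "a\<^sup>2 - d\<^sup>2 = s * t"
    by (simp_all add: a_b_d_def power2_eq_square field_simps)
  have one: "a\<^sup>2 + 2 * b\<^sup>2 + d\<^sup>2 = 1"
    using ad(1) unfolding b by argo
  \<comment> \<open>Each of the four Bloch vectors is (0, 0, a^2 - d^2).\<close>
  have S: "4 * (a\<^sup>2 - d\<^sup>2)\<^sup>2 = S"
    unfolding U(3)[symmetric] ad(3) power_mult_distrib st by simp
  have r': "2 * (a * d + b\<^sup>2) = r"
    unfolding ad(2) b st by (simp add: field_simps)
  define \<psi> :: "complex vec" where
    "\<psi> = vec 16 (\<lambda>i. if i = 0 then of_real a else if i = 3 \<or> i = 12 then of_real b else if i = 15 then of_real d else 0)"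
  have "\<psi> \<bullet>c \<psi> = of_real (a\<^sup>2 + 2 * b\<^sup>2 + d\<^sup>2)"
    unfolding \<psi>_def scalar_prod_vec_numerals sum_lessThan_numerals by (simp add: power2_eq_square)
  then have "pure_state 4 \<psi>"
    by (simp add: pure_state_def one) (simp add: \<psi>_def)
  moreover have "sector_length 4 1 (ketbra \<psi>) = S"
    by (subst sector_length_one)
      (simp_all add: \<psi>_def pauli_elem_unfold flip: numeral_2_eq_2 numeral_3_eq_3 S, simp add: power2_eq_square)
  moreover have "singlet_form 4 (($) \<psi>) (($) \<psi>) = of_real (2 * (a * d + b\<^sup>2))"
    by (simp add: \<psi>_def singlet_form_numeral power2_eq_square flip: numeral_2_eq_2 numeral_3_eq_3)
  then have "4 * (cmod (singlet_form 4 (($) \<psi>) (($) \<psi>)))\<^sup>2 = D"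
    unfolding r' D by simp
  ultimately show ?thesis by (rule that)
qed

section \<open>Description of the three sets of sector length vectors\<close>

lemma sector_length_vector_eq:
  "sector_length_vector 2 \<psi> = vec_of_list [sector_length 2 1 (ketbra \<psi>), sector_length 2 2 (ketbra \<psi>)]"
  "sector_length_vector 3 \<psi> = vec_of_list [sector_length 3 1 (ketbra \<psi>), sector_length 3 2 (ketbra \<psi>),
     sector_length 3 3 (ketbra \<psi>)]"
  "sector_length_vector 4 \<psi> = vec_of_list [sector_length 4 1 (ketbra \<psi>), sector_length 4 2 (ketbra \<psi>),
     sector_length 4 3 (ketbra \<psi>), sector_length 4 4 (ketbra \<psi>)]"
  by (rule eq_vecI; auto simp: sector_length_vector_def vec_of_list_index less_Suc_eq numeral_eq_Suc)+

theorem mainTheorem2: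
  shows
    "pure_sector_length_vectors 2 =
       {vec_of_list [S1, S2] | S1 S2 :: real. 0 \<le> S1 \<and> S1 \<le> 2 \<and> S2 = 3 - S1} \<and>
     pure_sector_length_vectors 3 =
       {vec_of_list [S1, S2, S3] | S1 S2 S3 :: real.
          0 \<le> S1 \<and> S1 \<le> 3 \<and> S2 = 3 \<and> S3 = 4 - S1} \<and>
     pure_sector_length_vectors 4 =
       {vec_of_list [S1, S2, S3, S4] | S1 S2 S3 S4 :: real.
          0 \<le> S1 \<and> S1 \<le> S2 - 2 \<and> S2 - 2 \<le> 4 \<and>
          S3 = 12 + S1 - 2 * S2 \<and> S4 = 3 - 2 * S1 + S2}"
    (is "?P2 = ?R2 \<and> ?P3 = ?R3 \<and> ?P4 = ?R4")
proof (intro conjI)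
  show "?P2 = ?R2"
  proof (intro equalityI subsetI)
    fix v assume "v \<in> ?P2"
    then show "v \<in> ?R2"
      using sector_lengths_2 sector_length_nonneg
      by (force simp: pure_sector_length_vectors_def sector_length_vector_eq)
  next
    fix v assume "v \<in> ?R2"
    then obtain S1 where v: "v = vec_of_list [S1, 3 - S1]" "0 \<le> S1" "S1 \<le> 2"
      by blast
    then obtain \<psi> where "pure_state 2 \<psi>" "sector_length 2 1 (ketbra \<psi>) = S1"
      using exists_pure_state_2 by metis
    then have "pure_state 2 \<psi>" "v = sector_length_vector 2 \<psi>"
      using sector_lengths_2[of \<psi>] by (simp_all add: v sector_length_vector_eq)
    then show "v \<in> ?P2"
      unfolding pure_sector_length_vectors_def by blast
  qed
  show "?P3 = ?R3"
  proof (intro equalityI subsetI)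
    fix v assume "v \<in> ?P3"
    then show "v \<in> ?R3"
      using sector_lengths_3 sector_length_3_1_le sector_length_nonneg
      by (force simp: pure_sector_length_vectors_def sector_length_vector_eq)
  next
    fix v assume "v \<in> ?R3"
    then obtain S1 where v: "v = vec_of_list [S1, 3, 4 - S1]" "0 \<le> S1" "S1 \<le> 3"
      by blast
    then obtain \<psi> where "pure_state 3 \<psi>" "sector_length 3 1 (ketbra \<psi>) = S1"
      using exists_pure_state_3 by metis
    then have "pure_state 3 \<psi>" "v = sector_length_vector 3 \<psi>"
      using sector_lengths_3[of \<psi>] by (simp_all add: v sector_length_vector_eq)
    then show "v \<in> ?P3"
      unfolding pure_sector_length_vectors_def by blast
  qed
  show "?P4 = ?R4"
  proof (intro equalityI subsetI)
    fix v assume "v \<in> ?P4"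
    then obtain \<psi> where \<psi>: "pure_state 4 \<psi>" "v = sector_length_vector 4 \<psi>"
      unfolding pure_sector_length_vectors_def by blast
    let ?S = "\<lambda>m. sector_length 4 m (ketbra \<psi>)"
    \<comment> \<open>Since S_2 - 2 = S_1 + 4 |t|^2, the lower bound is |t|^2 \<ge> 0 and the upper
      one is the summed Bloch bound.\<close>
    have "0 \<le> ?S 1 \<and> ?S 1 \<le> ?S 2 - 2 \<and> ?S 2 - 2 \<le> 4"
      using sector_lengths_4(1)[OF \<psi>(1)] sector_length_4_1_le[OF \<psi>(1)] sector_length_nonneg by auto
    then show "v \<in> ?R4"
      using sector_lengths_4(2,3)[OF \<psi>(1)] unfolding \<psi>(2) sector_length_vector_eq by blast
  next
    fix v assume "v \<in> ?R4"
    then obtain S1 S2 where v: "v = vec_of_list [S1, S2, 12 + S1 - 2 * S2, 3 - 2 * S1 + S2]"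
        "0 \<le> S1" "S1 \<le> S2 - 2" "S2 - 2 \<le> 4"
      by blast
    \<comment> \<open>S_2 is prescribed through 4 |t|^2 = S_2 - 2 - S_1; the linear relations then
      fix S_3 and S_4.\<close>
    then obtain \<psi> where "pure_state 4 \<psi>" "sector_length 4 1 (ketbra \<psi>) = S1"
        "4 * (cmod (singlet_form 4 (($) \<psi>) (($) \<psi>)))\<^sup>2 = S2 - 2 - S1"
      using exists_pure_state_4[of S1 "S2 - 2 - S1"] by auto
    then have "pure_state 4 \<psi>" "v = sector_length_vector 4 \<psi>"
      using sector_lengths_4[of \<psi>] by (simp_all add: v sector_length_vector_eq)
    then show "v \<in> ?P4"
      unfolding pure_sector_length_vectors_def by blast
  qed
qed

end
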